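(* (1) Let $n\ge 2$. For any continuous function $f:S^{n-1}\to\mathbb{R}^{n-2}$, there exist orthogonal elements $v_1,v_2$ of $S^{n-1}$ such that $f(v_1)=f(v_2)$. (2) Let $n\ge 4$. For any continuous function $f:S^{n-1}\to\mathbb{R}^{\lfloor n/2\rfloor-2}$, there exist mutually orthogonal elements $v_1,v_2,v_3,v_4$ of $S^{n-1}$ such that $f(v_1)=f(v_2)$ and $f(v_3)=f(v_4)$. (3) Let $n\ge 6$. For any continuous function $f:S^{n-1}\to\mathbb{R}^{\lfloor (n-r_n-1)/3\rfloor}$, there exist mutually orthogonal elements $v_1,v_2,v_3,v_4,v_5,v_6$ of $S^{n-1}$ such that $f(v_1)=f(v_2)$, $f(v_3)=f(v_4)$ and $f(v_5)=f(v_6)$, where $r_n=5$ if $n\equiv 1,2\pmod 4$, $r_n=4$ if $n\equiv 0\pmod 4$, and $r_n=3$ if $n\equiv 3\pmod 4$.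
   Context: $S^{n-1}$ is the unit sphere in $\mathbb{R}^n$ with the Euclidean inner product. *)

theory Defs
  imports "HOL-Analysis.Analysis"
begin

(* As in the library's Euclidean_space n and nsphere (n - 1), a vector of R^n is a
   sequence nat => real that vanishes from index n on; Euclidean_space 0 is a point. *)

definition euclidean_inner :: "nat \<Rightarrow> (nat \<Rightarrow> real) \<Rightarrow> (nat \<Rightarrow> real) \<Rightarrow> real" where
  "euclidean_inner n v w = (\<Sum>i<n. v i * w i)"

(* Orthogonality is required of entries at distinct positions, so that a list with a
   repeated nonzero entry is not orthogonal. *)
definition mutually_orthogonal :: "nat \<Rightarrow> (nat \<Rightarrow> real) list \<Rightarrow> bool" where
  "mutually_orthogonal n vs \<longleftrightarrow>
     (\<forall>i<length vs. \<forall>j<length vs. i \<noteq> j \<longrightarrow> euclidean_inner n (vs ! i) (vs ! j) = 0)"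

(* For n \<ge> 6 we have r_offset n + 1 \<le> n, so the natural-number subtraction
   n - r_offset n - 1 does not truncate. *)
definition r_offset :: "nat \<Rightarrow> nat" where
  "r_offset n = (if n mod 4 = 1 \<or> n mod 4 = 2 then 5 else if n mod 4 = 0 then 4 else 3)"

end

theory Submission
  imports Defs "HOL-Homology.Homology"
begin

text \<open>
  If \<open>e\<close> and \<open>x\<close> are orthogonal unit vectors, then so are \<open>(e + x) / sqrt 2\<close> and \<open>(e - x) / sqrt 2\<close>, and
  \<open>x \<mapsto> f ((e + x) / sqrt 2) - f ((e - x) / sqrt 2)\<close> is odd. Orthogonality of \<open>x\<close> to a given vector is also
  the vanishing of an odd function of \<open>x\<close>, so Borsuk-Ulam yields such a pair orthogonal to any \<open>j\<close>
  prescribed vectors, provided that \<open>j + 1\<close> plus the dimension of the target of \<open>f\<close> is at most \<open>n - 1\<close>.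
  Choosing the pairs one after another (\<open>j = 0, 2, 4\<close>) proves the three claims, since the target
  dimensions are at most \<open>n - 2\<close>, \<open>n - 4\<close> and \<open>n - 6\<close>.

  For Borsuk-Ulam, an odd map from the \<open>(m+1)\<close>-sphere to the \<open>m\<close>-sphere is excluded by chasing the chains
  of hemispheres: the boundary of the \<open>k\<close>-th one is the \<open>(k-1)\<close>-th one plus or minus its antipode. The fundamental class
  of the \<open>m\<close>-sphere is represented by two antipodal copies of the top hemisphere and is not divisible by
  two. The images of the hemispheres of the \<open>(m+1)\<close>-sphere under an odd map agree with those of the
  \<open>m\<close>-sphere up to antipodally symmetric corrections, which change the class only by multiples of two;
  but the image of the last hemisphere makes it a boundary.
\<close>

lemma frag_cmul_diff_distrib2: "frag_cmul c (a - b) = frag_cmul c a - frag_cmul c b"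
  by (rule poly_mapping_eqI) (simp add: lookup_minus algebra_simps)

subsection \<open>Homology at the level of chains\<close>

lemma singular_boundary_imp_relboundary:
  "singular_relboundary p X {} c \<Longrightarrow> singular_relboundary p X S c"
  unfolding singular_relboundary by (auto simp: singular_chain_empty intro: exI [of _ 0])

text \<open>\<open>chain_map p id\<close> fixes every chain of \<open>X\<close>, so an inclusion
  acts on homology classes by keeping their representatives. This lets the next two lemmas turn an
  isomorphism of groups into statements about chains.\<close>

lemma hom_induced_inclusion_class:
  assumes "continuous_map X Y id" "S \<subseteq> T" "singular_relcycle p X S x"
  shows "hom_induced (int p) X S Y T id (homologous_rel_set p X S x) = homologous_rel_set p Y T x"
proof -
  have "chain_map p id x = x"
    using assms(3) by (auto simp: singular_relcycle intro: chain_map_ident)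
  then show ?thesis
    using hom_induced_chain_map [of X Y id S T p x] assms by (simp add: Pi_iff subset_iff)
qed

lemma epi_inclusion_imp_homologous:
  assumes "continuous_map X Y id" "S \<subseteq> T"
    and iso: "hom_induced (int p) X S Y T id
               \<in> iso (relative_homology_group (int p) X S) (relative_homology_group (int p) Y T)"
    and y: "singular_relcycle p Y T y"
  obtains x where "singular_relcycle p X S x" "homologous_rel p Y T x y"
proof -
  have "homologous_rel_set p Y T y \<in> carrier (relative_homology_group (int p) Y T)"
    using y by (auto simp: carrier_relative_homology_group)
  also have "\<dots> = hom_induced (int p) X S Y T id ` carrier (relative_homology_group (int p) X S)"
    using iso by (auto simp: iso_iff)
  finally obtain x where x: "singular_relcycle p X S x"
    and "homologous_rel_set p Y T y = hom_induced (int p) X S Y T id (homologous_rel_set p X S x)"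
    by (auto simp: carrier_relative_homology_group)
  then have "homologous_rel_set p Y T x = homologous_rel_set p Y T y"
    using assms by (simp add: hom_induced_inclusion_class)
  then show thesis
    using that x by (simp add: homologous_rel_set_eq)
qed

lemma mon_inclusion_imp_relboundary:
  assumes "continuous_map X Y id" "S \<subseteq> T"
    and iso: "hom_induced (int p) X S Y T id
               \<in> iso (relative_homology_group (int p) X S) (relative_homology_group (int p) Y T)"
    and x: "singular_relcycle p X S x" "singular_relboundary p Y T x"
  shows "singular_relboundary p X S x"
proof -
  have inj: "inj_on (hom_induced (int p) X S Y T id) (carrier (relative_homology_group (int p) X S))"
    using iso by (simp add: iso_iff)
  have "hom_induced (int p) X S Y T id (homologous_rel_set p X S x)
      = hom_induced (int p) X S Y T id (homologous_rel_set p X S 0)"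
    using assms hom_induced_inclusion_class [OF assms(1,2) singular_relcycle_0]
    by (simp add: hom_induced_inclusion_class homologous_rel_set_eq) (simp add: homologous_rel_def)
  then have "homologous_rel_set p X S x = homologous_rel_set p X S 0"
    by (rule inj_onD [OF inj]) (use x in \<open>auto simp: carrier_relative_homology_group intro: singular_relcycle_0\<close>)
  then show ?thesis
    unfolding homologous_rel_set_eq by (simp add: homologous_rel_def)
qed

text \<open>In degree 0, differences of two points are the only cycles of augmentation 0 that occur below.\<close>

definition reduced_cycle :: "nat \<Rightarrow> 'a topology \<Rightarrow> 'a chain \<Rightarrow> bool"
  where "reduced_cycle p X z \<longleftrightarrow>
    singular_relcycle p X {} z \<and> (p = 0 \<longrightarrow> (\<exists>u v. z = frag_of u - frag_of v))"

text \<open>In positive degree the reduced and unreduced groups agree. In degree 0 the reduced group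
  is the kernel of the map to a one-point space, where \<open>u\<close> and \<open>v\<close> become
  the same simplex and cancel.\<close>

lemma reduced_cycle_class:
  assumes "reduced_cycle p X z"
  shows "homologous_rel_set p X {} z \<in> carrier (reduced_homology_group (int p) X)"
proof (cases "p = 0")
  case False
  then show ?thesis
    using assms by (auto simp: un_reduced_homology_group carrier_relative_homology_group reduced_cycle_def)
next
  case True
  let ?P = "discrete_topology {()}"
  have z: "singular_relcycle 0 X {} z"
    using assms True by (simp add: reduced_cycle_def)
  obtain u v where "z = frag_of u - frag_of v"
    using assms True by (auto simp: reduced_cycle_def)
  moreover have "simplex_map 0 (\<lambda>x. ()) u = simplex_map 0 (\<lambda>x. ()) v"
    by (simp add: simplex_map_def o_def)
  ultimately have "chain_map 0 (\<lambda>x. ()) z = 0"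
    by (simp add: chain_map_diff)
  then have "hom_induced (int 0) X {} ?P {} (\<lambda>x. ()) (homologous_rel_set 0 X {} z)
      = homologous_rel_set 0 ?P {} 0"
    using hom_induced_chain_map [of X ?P "\<lambda>x. ()" "{}" "{}" 0 z] z by simp
  also have "\<dots> = \<one>\<^bsub>homology_group (int 0) ?P\<^esub>"
    unfolding one_relative_homology_group homologous_rel_set_eq_relboundary by simp
  finally show ?thesis
    using z True carrier_relative_homology_group [of 0 X "{}"]
    by (auto simp: carrier_reduced_homology_group kernel_def simp del: one_relative_homology_group)
qed

lemma reduced_cycle_imp_boundary:
  assumes "trivial_group (reduced_homology_group (int p) X)" "reduced_cycle p X z"
  shows "singular_relboundary p X {} z"
proof -
  have "homologous_rel_set p X {} z = \<one>\<^bsub>homology_group (int p) X\<^esub>"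
    using reduced_cycle_class [OF assms(2)] assms(1) by (simp add: trivial_group_def one_reduced_homology_group)
  then show ?thesis
    by (simp add: homologous_rel_set_eq_relboundary)
qed

subsection \<open>The antipodal action on chains\<close>

definition antipode :: "(nat \<Rightarrow> real) \<Rightarrow> nat \<Rightarrow> real"
  where "antipode x = (\<lambda>i. - x i)"

lemma antipode_antipode [simp]: "antipode (antipode x) = x"
  by (simp add: antipode_def)

lemma continuous_map_antipode: "continuous_map (nsphere m) (nsphere m) antipode"
proof -
  have "continuous_map (powertop_real UNIV) euclideanreal (\<lambda>x. - x i)" for i :: nat
    by (intro continuous_map_minus continuous_map_product_projection) auto
  then show ?thesis
    by (force simp: nsphere continuous_map_in_subtopology antipode_def
        continuous_map_componentwise_UNIV intro: continuous_map_from_subtopology)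
qed

text \<open>This is the operator 1 + s A, with A the antipodal chain map in degree \<open>k\<close>;
  it is used with \<open>s\<close> equal to 1 or -1.\<close>

definition twist :: "int \<Rightarrow> nat \<Rightarrow> (nat \<Rightarrow> real) chain \<Rightarrow> (nat \<Rightarrow> real) chain"
  where "twist s k c = c + frag_cmul s (chain_map k antipode c)"

lemma twist_0 [simp]: "twist s k 0 = 0"
  by (simp add: twist_def)

lemma twist_add: "twist s k (a + b) = twist s k a + twist s k b"
  by (simp add: twist_def chain_map_add frag_cmul_distrib2)

lemma twist_diff: "twist s k (a - b) = twist s k a - twist s k b"
  by (simp add: twist_def chain_map_diff frag_cmul_diff_distrib2)

lemma singular_chain_twist:
  "singular_chain k (nsphere m) c \<Longrightarrow> singular_chain k (nsphere m) (twist s k c)"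
  unfolding twist_def
  by (intro singular_chain_add singular_chain_cmul singular_chain_chain_map [OF _ continuous_map_antipode])

lemma chain_boundary_twist:
  assumes "singular_chain (Suc k) X c"
  shows "chain_boundary (Suc k) (twist s (Suc k) c) = twist s k (chain_boundary (Suc k) c)"
  using chain_boundary_chain_map [OF assms, of antipode]
  by (simp add: twist_def chain_boundary_add chain_boundary_cmul)

lemma chain_map_antipode_antipode:
  assumes "singular_chain k X c"
  shows "chain_map k antipode (chain_map k antipode c) = c"
proof -
  have "chain_map k antipode (chain_map k antipode c) = chain_map k (antipode \<circ> antipode) c"
    by (simp add: chain_map_compose)
  also have "\<dots> = c"
    using assms by (intro chain_map_id_gen) auto
  finally show ?thesis .
qed

text \<open>(1 + s A)(1 - s A) = 1 - s^2 A^2, and A is an involution.\<close>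

lemma twist_twist:
  assumes "singular_chain k X c" "s * s = 1"
  shows "twist s k (twist (- s) k c) = 0"
  using assms chain_map_antipode_antipode [OF assms(1)]
  by (simp add: twist_def chain_map_diff frag_cmul_diff_distrib2 flip: minus_frag_cmul)

text \<open>The antipode is a homeomorphism, so its Brouwer degree is 1 or -1, and it acts on the
  reduced top homology as multiplication by that degree.\<close>

lemma homologous_chain_map_antipode:
  assumes z: "reduced_cycle m (nsphere m) z"
  shows "homologous_rel m (nsphere m) {} (chain_map m antipode z) z
       \<or> homologous_rel m (nsphere m) {} (chain_map m antipode z) (- z)"
proof -
  let ?G = "reduced_homology_group (int m) (nsphere m)"
  let ?H = "homology_group (int m) (nsphere m)"
  let ?x = "homologous_rel_set m (nsphere m) {} z"
  interpret H: group ?H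
    by simp
  have x: "?x \<in> carrier ?G"
    by (rule reduced_cycle_class [OF z])
  then have xH: "?x \<in> carrier ?H"
    using carrier_reduced_homology_group_subset by blast
  \<comment> \<open>The degree is characterised by powers in the reduced group, whereas classes of
    chains are computed in the full homology group.\<close>
  have pow: "?x [^]\<^bsub>?G\<^esub> n = ?x [^]\<^bsub>?H\<^esub> n" for n :: int
    using x unfolding reduced_homology_group_def by (rule H.int_pow_subgroup_generated)
  have "homeomorphic_map (nsphere m) (nsphere m) antipode"
    unfolding homeomorphic_map_maps homeomorphic_maps_def
    by (rule exI [of _ antipode]) (auto simp: continuous_map_antipode)
  then have "\<bar>Brouwer_degree2 m antipode\<bar> = 1"
    by (rule Brouwer_degree2_homeomorphic_map)
  moreover have eq: "homologous_rel_set m (nsphere m) {} (chain_map m antipode z)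
      = ?x [^]\<^bsub>?H\<^esub> Brouwer_degree2 m antipode"
    using Brouwer_degree2 [OF x, of antipode] z
      hom_induced_chain_map [OF continuous_map_antipode, of "{}" "{}" m m z]
    by (simp add: pow reduced_cycle_def)
  moreover have "inv\<^bsub>?H\<^esub> ?x = uminus ` ?x"
    using xH by (rule inv_relative_homology_group)
  ultimately consider "homologous_rel_set m (nsphere m) {} (chain_map m antipode z) = ?x"
    | "homologous_rel_set m (nsphere m) {} (chain_map m antipode z) = uminus ` ?x"
    using xH abs_eq_iff' [of "Brouwer_degree2 m antipode" 1] by (auto simp: H.int_pow_neg H.int_pow_1)
  then show ?thesis
  proof cases
    case 1
    then show ?thesis
      by (simp add: homologous_rel_set_eq)
  next
    case 2
    have "- z \<in> uminus ` ?x"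
      by simp
    then show ?thesis
      unfolding 2 [symmetric] by simp
  qed
qed

section \<open>Homology classes divisible by two\<close>

text \<open>Divisibility by two of the integral class stands in for the vanishing of the class mod 2.\<close>

definition even_class :: "nat \<Rightarrow> (nat \<Rightarrow> real) chain \<Rightarrow> bool"
  where "even_class m c \<longleftrightarrow>
    (\<exists>y. singular_relcycle m (nsphere m) {} y \<and> homologous_rel m (nsphere m) {} c (y + y))"

text \<open>Since A z is homologous to z or -z, the class of z + s A z is either 2z or 0, and both
  are divisible by two.\<close>

lemma even_class_twist:
  assumes "reduced_cycle m (nsphere m) z" "s = 1 \<or> s = - 1"
  shows "even_class m (twist s m z)"
proof -
  let ?h = "homologous_rel m (nsphere m) {}"
  let ?A = "chain_map m antipode z"
  consider "s = 1" "?h ?A z" | "s = 1" "?h ?A (- z)" | "s = - 1" "?h ?A z" | "s = - 1" "?h ?A (- z)"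
    using homologous_chain_map_antipode [OF assms(1)] assms(2) by argo
  then have "?h (twist s m z) (z + z) \<or> ?h (twist s m z) 0"
  proof cases
    case 1
    then show ?thesis
      using homologous_rel_add [OF homologous_rel_refl, of m "nsphere m" "{}" ?A z z] by (simp add: twist_def)
  next
    case 2
    then show ?thesis
      using homologous_rel_add [OF homologous_rel_refl, of m "nsphere m" "{}" ?A "- z" z] by (simp add: twist_def)
  next
    case 3
    then show ?thesis
      using homologous_rel_diff [OF homologous_rel_refl, of m "nsphere m" "{}" ?A z z] by (simp add: twist_def)
  next
    case 4
    then show ?thesis
      using homologous_rel_diff [OF homologous_rel_refl, of m "nsphere m" "{}" ?A "- z" z] by (simp add: twist_def)
  qed
  then show ?thesis
  proof
    assume "?h (twist s m z) 0"
    then show ?thesis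
      unfolding even_class_def by (intro exI [of _ 0]) simp
  qed (use assms(1) in \<open>auto simp: even_class_def reduced_cycle_def\<close>)
qed

lemma even_class_minus:
  assumes "even_class m c"
  shows "even_class m (- c)"
proof -
  obtain y where y: "singular_relcycle m (nsphere m) {} y" "homologous_rel m (nsphere m) {} c (y + y)"
    using assms by (auto simp: even_class_def)
  have "homologous_rel m (nsphere m) {} (- c) (- y + - y)"
    using homologous_rel_diff [OF homologous_rel_refl [of m "nsphere m" "{}" 0] y(2)] by simp
  then show ?thesis
    unfolding even_class_def using y(1) by (intro exI [of _ "- y"]) (simp add: singular_relcycle_minus)
qed

lemma even_class_homologous:
  "\<lbrakk>even_class m c; homologous_rel m (nsphere m) {} c' c\<rbrakk> \<Longrightarrow> even_class m c'"
  unfolding even_class_def by (auto intro: homologous_rel_trans)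

section \<open>Hemisphere chains and the fundamental class\<close>

text \<open>\<open>c k\<close> plays the role of a \<open>k\<close>-dimensional hemisphere.\<close>

definition antipodal_seq :: "nat \<Rightarrow> (nat \<Rightarrow> (nat \<Rightarrow> real) chain) \<Rightarrow> bool"
  where "antipodal_seq m c \<longleftrightarrow> (\<exists>v. c 0 = frag_of v)
    \<and> (\<forall>k\<le>m. singular_chain k (nsphere m) (c k))
    \<and> (\<forall>k<m. chain_boundary (Suc k) (c (Suc k)) = twist ((-1) ^ Suc k) k (c k))"

text \<open>The 0-sphere consists of two points, told apart by the sign of coordinate 0. Along a
  connected simplex this coordinate takes values in an interval that misses 0.\<close>

lemma singular_simplex_nsphere_0_constant:
  assumes f: "singular_simplex p (nsphere 0) f" and x: "x \<in> standard_simplex p" and y: "y \<in> standard_simplex p"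
  shows "f x = f y"
proof -
  have cf: "continuous_map (subtopology (powertop_real UNIV) (standard_simplex p)) (nsphere 0) f"
    using f by (simp add: singular_simplex_def)
  have pt: "(u 0)\<^sup>2 = 1 \<and> (\<forall>i>0. u i = 0)" if "u \<in> topspace (nsphere 0)" for u
    using that by (simp add: nsphere)
  have top: "f u \<in> topspace (nsphere 0)" if "u \<in> standard_simplex p" for u
    using cf that by (auto simp: continuous_map_def)
  have "connectedin (subtopology (powertop_real UNIV) (standard_simplex p)) (standard_simplex p)"
    by (simp add: connectedin_subtopology connectedin_standard_simplex)
  moreover have "continuous_map (subtopology (powertop_real UNIV) (standard_simplex p)) euclideanreal (\<lambda>u. f u 0)"
    using continuous_map_compose [OF cf continuous_map_nsphere_projection] by (simp add: o_def)
  ultimately have "connected ((\<lambda>u. f u 0) ` standard_simplex p)"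
    using connectedin_continuous_map_image by fastforce
  then have int: "is_interval ((\<lambda>u. f u 0) ` standard_simplex p)"
    by (simp add: is_interval_connected_1)
  have "0 \<notin> (\<lambda>u. f u 0) ` standard_simplex p"
    using pt top by fastforce
  then have "\<not> (f a 0 \<le> 0 \<and> 0 \<le> f b 0)" if "a \<in> standard_simplex p" "b \<in> standard_simplex p" for a b
    using int that unfolding is_interval_1 by blast
  then have "f x 0 = f y 0"
    using pt [OF top [OF x]] pt [OF top [OF y]] x y
    by (metis linorder_le_cases power2_eq_1_iff zero_le_one neg_le_0_iff_le)
  then show ?thesis
    using pt [OF top [OF x]] pt [OF top [OF y]] by (metis ext gr0I)
qed

text \<open>The two faces of a constant 1-simplex coincide and enter the boundary with opposite
  signs. Hence homologous 0-chains of the 0-sphere are equal.\<close>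

lemma chain_boundary_nsphere_0:
  assumes "singular_chain (Suc 0) (nsphere 0) d"
  shows "chain_boundary (Suc 0) d = 0"
  using assms unfolding singular_chain_def
proof (induction rule: frag_induction)
  case (one f)
  then have f: "singular_simplex (Suc 0) (nsphere 0) f"
    by simp
  have "singular_face (Suc 0) 0 f = singular_face (Suc 0) (Suc 0) f"
    unfolding singular_face_def
  proof (rule restrict_ext)
    fix x :: "nat \<Rightarrow> real"
    assume "x \<in> standard_simplex (Suc 0 - Suc 0)"
    then have "simplical_face k x \<in> standard_simplex (Suc 0)" if "k \<le> Suc 0" for k
      using that by (intro simplical_face_in_standard_simplex) auto
    then show "(f \<circ> simplical_face 0) x = (f \<circ> simplical_face (Suc 0)) x"
      using singular_simplex_nsphere_0_constant [OF f] by simp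
  qed
  then show ?case
    by (simp add: chain_boundary_of)
qed (auto simp: chain_boundary_diff)

lemma antipodal_seq_0:
  "\<exists>c. antipodal_seq 0 c \<and> \<not> even_class 0 (twist ((-1) ^ Suc 0) 0 (c 0))"
proof -
  define e :: "nat \<Rightarrow> real" where "e = (\<lambda>i. if i = 0 then 1 else 0)"
  define v where "v = restrict (\<lambda>_. e) (standard_simplex 0)"
  have "e \<in> topspace (nsphere 0)"
    using in_topspace_nsphere by (simp add: e_def)
  then have v: "singular_chain 0 (nsphere 0) (frag_of v)"
    by (simp add: singular_chain_of singular_simplex_def v_def)
  have "\<not> even_class 0 (twist ((-1) ^ Suc 0) 0 (frag_of v))"
  proof
    assume "even_class 0 (twist ((-1) ^ Suc 0) 0 (frag_of v))"
    then obtain y d where d: "singular_chain (Suc 0) (nsphere 0) d"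
      "chain_boundary (Suc 0) d = twist (-1) 0 (frag_of v) - (y + y)"
      unfolding even_class_def homologous_rel_def singular_boundary by auto
    then have "frag_of v - frag_of (simplex_map 0 antipode v) = y + y"
      using chain_boundary_nsphere_0 [OF d(1)] by (simp add: twist_def)
    \<comment> \<open>The coefficient at \<open>v\<close> is 1 on the left, because \<open>v\<close>
      differs from its antipode, and even on the right.\<close>
    then have "Poly_Mapping.lookup (frag_of v - frag_of (simplex_map 0 antipode v)) v = Poly_Mapping.lookup (y + y) v"
      by simp
    moreover have "v \<noteq> simplex_map 0 antipode v"
    proof
      assume "v = simplex_map 0 antipode v"
      then have "v (\<lambda>j. if j = 0 then 1 else 0) = simplex_map 0 antipode v (\<lambda>j. if j = 0 then 1 else 0)"
        by simp
      then have "e = antipode e"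
        by (simp add: v_def simplex_map_def standard_simplex_0)
      then have "e 0 = - e 0"
        by (metis antipode_def)
      then show False
        by (simp add: e_def)
    qed
    ultimately have "1 = 2 * Poly_Mapping.lookup y v"
      by (simp add: lookup_minus lookup_add)
    then show False
      by presburger
  qed
  moreover have "antipodal_seq 0 (\<lambda>_. frag_of v)"
    using v by (auto simp: antipodal_seq_def)
  ultimately show ?thesis
    by blast
qed

text \<open>The boundary of \<open>c m\<close> is a twist with the opposite sign, so the outer twist
  annihilates it by \<open>twist_twist\<close>. For \<open>m = 0\<close> the result is a point minus
  its antipode.\<close>

lemma antipodal_seq_twist_cycle:
  assumes "antipodal_seq m c"
  shows "reduced_cycle m (nsphere m) (twist ((-1) ^ Suc m) m (c m))"
proof -
  have c: "singular_chain m (nsphere m) (c m)"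
    using assms by (simp add: antipodal_seq_def)
  have "chain_boundary m (twist ((-1) ^ Suc m) m (c m)) = 0"
  proof (cases m)
    case 0
    then show ?thesis
      by (simp add: chain_boundary_def)
  next
    case (Suc j)
    have cj: "chain_boundary (Suc j) (c (Suc j)) = twist ((-1) ^ Suc j) j (c j)" "singular_chain j (nsphere m) (c j)"
      using assms by (auto simp: antipodal_seq_def Suc)
    have "chain_boundary m (twist ((-1) ^ Suc m) m (c m)) = twist ((-1) ^ j) j (twist (- ((-1) ^ j)) j (c j))"
      using chain_boundary_twist [OF c [unfolded Suc]] cj by (simp add: Suc)
    then show ?thesis
      using twist_twist [OF cj(2), of "(-1) ^ j"] by (simp flip: power_mult_distrib)
  qed
  moreover obtain v where "c 0 = frag_of v"
    using assms by (auto simp: antipodal_seq_def)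
  then have "m = 0 \<Longrightarrow> twist ((-1) ^ Suc m) m (c m) = frag_of v - frag_of (simplex_map 0 antipode v)"
    by (simp add: twist_def)
  ultimately show ?thesis
    using singular_chain_twist [OF c] by (auto simp: singular_cycle reduced_cycle_def simp del: power_Suc)
qed

text \<open>The equatorial cycle bounds a chain \<open>w\<close> in the upper hemisphere
  \<open>U\<close>, which becomes the next term. If its twist were 2y, then modulo the lower
  hemisphere \<open>L\<close> also \<open>w\<close> would be 2y; excision moves this relation to the
  pair (\<open>U\<close>, \<open>E\<close>), and its boundary makes the equatorial class
  even.\<close>

lemma antipodal_seq_Suc:
  assumes c: "antipodal_seq m c" "\<not> even_class m (twist ((-1) ^ Suc m) m (c m))"
  shows "\<exists>c. antipodal_seq (Suc m) c \<and> \<not> even_class (Suc m) (twist ((-1) ^ Suc (Suc m)) (Suc m) (c (Suc m)))"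
proof -
  let ?S = "nsphere (Suc m)"
  define U where "U = subtopology ?S {x. x (Suc m) \<ge> 0}"
  define E where "E = {x :: nat \<Rightarrow> real. x (Suc m) = 0}"
  define L where "L = {x :: nat \<Rightarrow> real. x (Suc m) \<le> 0}"
  have SE: "subtopology ?S E = nsphere m"
    by (simp add: E_def subtopology_nsphere_equator)
  have UE: "subtopology U E = nsphere m"
  proof -
    have "{x :: nat \<Rightarrow> real. x (Suc m) \<ge> 0} \<inter> E = E"
      by (auto simp: E_def)
    then show ?thesis
      using SE by (simp add: U_def subtopology_subtopology)
  qed
  let ?z = "twist ((-1) ^ Suc m) m (c m)"
  have z: "reduced_cycle m (nsphere m) ?z"
    by (rule antipodal_seq_twist_cycle [OF c(1)])
  have chainU: "singular_chain k U a" if "singular_chain k (nsphere m) a" for k a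
    using that unfolding UE [symmetric] by (simp add: singular_chain_subtopology)
  have chainS: "singular_chain k ?S a" if "singular_chain k (nsphere m) a" for k a
    using that unfolding SE [symmetric] by (simp add: singular_chain_subtopology)
  have "reduced_cycle m U ?z"
    using z chainU by (auto simp: reduced_cycle_def singular_cycle)
  then have "singular_relboundary m U {} ?z"
    by (intro reduced_cycle_imp_boundary trivial_reduced_homology_group_contractible_space)
      (simp_all add: U_def contractible_space_upper_hemisphere)
  then obtain w where w: "singular_chain (Suc m) U w" and bw: "chain_boundary (Suc m) w = ?z"
    by (auto simp: singular_boundary)
  have wS: "singular_chain (Suc m) ?S w"
    using w by (simp add: U_def singular_chain_subtopology)
  have "\<not> even_class (Suc m) (twist ((-1) ^ Suc (Suc m)) (Suc m) w)"
  proof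
    let ?s = "(-1) ^ Suc (Suc m) :: int"
    let ?h = "homologous_rel (Suc m) ?S L"
    assume "even_class (Suc m) (twist ?s (Suc m) w)"
    then obtain y where y: "singular_relcycle (Suc m) ?S {} y"
      and wy: "homologous_rel (Suc m) ?S {} (twist ?s (Suc m) w) (y + y)"
      by (auto simp: even_class_def)
    have id: "continuous_map U ?S id" and EL: "E \<subseteq> L"
      by (auto simp: U_def E_def L_def continuous_map_from_subtopology)
    have iso: "hom_induced (int (Suc m)) U E ?S L id
        \<in> iso (relative_homology_group (int (Suc m)) U E) (relative_homology_group (int (Suc m)) ?S L)"
      unfolding U_def E_def L_def by (rule iso_relative_homology_group_upper_hemisphere)
    have "singular_relcycle (Suc m) ?S L y"
      using y unfolding singular_cycle by (simp add: singular_relcycle)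
    then obtain x where x: "singular_relcycle (Suc m) U E x" and xy: "?h x y"
      by (rule epi_inclusion_imp_homologous [OF id EL iso])
    \<comment> \<open>The antipode exchanges the hemispheres, so the second summand of the twist of
      \<open>w\<close> lies in \<open>L\<close> and vanishes relative to \<open>L\<close>.\<close>
    have "continuous_map U (subtopology ?S L) antipode"
      using continuous_map_antipode
      by (auto simp: U_def L_def antipode_def continuous_map_in_subtopology intro: continuous_map_from_subtopology)
    then have "singular_chain (Suc m) (subtopology ?S L) (chain_map (Suc m) antipode w)"
      by (rule singular_chain_chain_map [OF w])
    then have "?h (w + frag_cmul ?s (chain_map (Suc m) antipode w)) (w + 0)"
      by (intro homologous_rel_add homologous_rel_refl)
        (simp add: homologous_rel_def singular_chain_imp_relboundary singular_chain_cmul del: power_Suc)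
    then have "?h w (twist ?s (Suc m) w)"
      by (simp add: twist_def homologous_rel_sym)
    moreover have "?h (twist ?s (Suc m) w) (y + y)"
      using wy unfolding homologous_rel_def by (rule singular_boundary_imp_relboundary)
    moreover have "?h (y + y) (x + x)"
      using xy by (simp add: homologous_rel_add homologous_rel_sym)
    ultimately have "?h w (x + x)"
      by (meson homologous_rel_trans)
    then have bd: "singular_relboundary (Suc m) ?S L (w - (x + x))"
      by (simp add: homologous_rel_def)
    have "singular_relcycle (Suc m) U E w"
      using w z by (simp add: singular_relcycle bw UE singular_cycle reduced_cycle_def)
    then have "singular_relcycle (Suc m) U E (w - (x + x))"
      using x by (intro singular_relcycle_diff singular_relcycle_add)
    then have "singular_relboundary (Suc m) U E (w - (x + x))"
      by (rule mon_inclusion_imp_relboundary [OF id EL iso _ bd])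
    then obtain d e where d: "singular_chain (Suc (Suc m)) U d" and e: "singular_chain (Suc m) (nsphere m) e"
      and de: "chain_boundary (Suc (Suc m)) d + e = w - (x + x)"
      by (auto simp: singular_relboundary UE)
    let ?bx = "chain_boundary (Suc m) x"
    \<comment> \<open>Taking boundaries removes \<open>d\<close>; as \<open>e\<close> lies in the
      equator, \<open>?z\<close> and twice the boundary of \<open>x\<close> are homologous
      there.\<close>
    have "chain_boundary (Suc m) e = ?z - (?bx + ?bx)"
      using arg_cong [OF de, of "chain_boundary (Suc m)"] chain_boundary_boundary_alt [OF d] bw
      by (simp add: chain_boundary_add chain_boundary_diff)
    then have "homologous_rel m (nsphere m) {} ?z (?bx + ?bx)"
      using e by (auto simp: homologous_rel_def singular_boundary)
    moreover have "singular_relcycle m (nsphere m) {} ?bx"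
      using x chain_boundary_boundary_alt [of m U x] by (simp add: singular_relcycle UE singular_cycle)
    ultimately show False
      using c(2) by (auto simp: even_class_def)
  qed
  moreover have "antipodal_seq (Suc m) (c(Suc m := w))"
    using c(1) wS bw chainS by (auto simp: antipodal_seq_def le_Suc_eq less_Suc_eq)
  ultimately show ?thesis
    by (intro exI [of _ "c(Suc m := w)"]) simp
qed

lemma antipodal_seq_exists:
  "\<exists>c. antipodal_seq m c \<and> \<not> even_class m (twist ((-1) ^ Suc m) m (c m))"
  by (induction m) (use antipodal_seq_0 antipodal_seq_Suc in blast)+

section \<open>Odd maps between spheres\<close>

lemma chain_map_twist:
  assumes f: "\<And>x. x \<in> topspace X \<Longrightarrow> f (antipode x) = antipode (f x)" and a: "singular_chain k X a"
  shows "chain_map k f (twist s k a) = twist s k (chain_map k f a)"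
proof -
  have "chain_map k f (chain_map k antipode a) = chain_map k (f \<circ> antipode) a"
    by (simp add: chain_map_compose)
  also have "\<dots> = chain_map k (antipode \<circ> f) a"
    using a f by (intro chain_map_eq) auto
  also have "\<dots> = chain_map k antipode (chain_map k f a)"
    by (simp add: chain_map_compose)
  finally show ?thesis
    by (simp add: twist_def chain_map_add)
qed

text \<open>The pushed-forward hemispheres \<open>d\<close> and the standard ones \<open>c\<close>
  obey the same boundary relations, so the twist of \<open>D m\<close> is even although
  \<open>D m\<close> need not be a cycle. As \<open>d (Suc m)\<close> bounds the twist of
  \<open>d m\<close>, the twist of \<open>c m\<close> would be even as well.\<close>

theorem no_odd_map_to_lower_sphere:
  assumes f: "continuous_map (nsphere (Suc m)) (nsphere m) f"
    and odd: "\<And>x. x \<in> topspace (nsphere (Suc m)) \<Longrightarrow> f (antipode x) = antipode (f x)"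
  shows False
proof -
  obtain c where c: "antipodal_seq m c" and odd_class: "\<not> even_class m (twist ((-1) ^ Suc m) m (c m))"
    using antipodal_seq_exists by blast
  obtain b where b: "antipodal_seq (Suc m) b"
    using antipodal_seq_exists by blast
  define d where "d k = chain_map k f (b k)" for k
  define D where "D k = d k - c k" for k
  let ?S = "nsphere m"
  have chd: "singular_chain k ?S (d k)" if "k \<le> Suc m" for k
    using b that unfolding d_def antipodal_seq_def by (blast intro: singular_chain_chain_map f)
  have bd: "chain_boundary (Suc k) (d (Suc k)) = twist ((-1) ^ Suc k) k (d k)" if "k \<le> m" for k
  proof -
    have bk: "singular_chain (Suc k) (nsphere (Suc m)) (b (Suc k))" "singular_chain k (nsphere (Suc m)) (b k)"
      "chain_boundary (Suc k) (b (Suc k)) = twist ((-1) ^ Suc k) k (b k)"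
      using b that by (auto simp: antipodal_seq_def)
    have "chain_boundary (Suc k) (d (Suc k)) = chain_map k f (chain_boundary (Suc k) (b (Suc k)))"
      using chain_boundary_chain_map [OF bk(1)] by (simp add: d_def)
    then show ?thesis
      using chain_map_twist [where f = f, OF _ bk(2)] odd by (simp add: d_def bk(3))
  qed
  have chD: "singular_chain k ?S (D k)" if "k \<le> m" for k
    using chd [of k] c that by (simp add: D_def antipodal_seq_def singular_chain_diff)
  have bD: "chain_boundary (Suc k) (D (Suc k)) = twist ((-1) ^ Suc k) k (D k)" if "k < m" for k
    using c that bd [of k] by (simp add: D_def chain_boundary_diff twist_diff antipodal_seq_def del: power_Suc)
  have D0: "reduced_cycle 0 ?S (D 0)"
  proof -
    obtain u v where "b 0 = frag_of u" "c 0 = frag_of v"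
      using b c by (auto simp: antipodal_seq_def)
    then have "D 0 = frag_of (simplex_map 0 f u) - frag_of v"
      by (simp add: D_def d_def)
    then show ?thesis
      using chD [of 0] by (auto simp: reduced_cycle_def singular_cycle chain_boundary_def)
  qed
  \<comment> \<open>The boundary of \<open>D (Suc k)\<close> is a twist of \<open>D k\<close>. This
    twist kills the \<open>e\<close> term, whose sign is opposite, and leaves the boundary of the
    twist of \<open>h\<close>.\<close>
  have step: "\<exists>h. singular_chain (Suc k) ?S h \<and> reduced_cycle (Suc k) ?S (D (Suc k) - twist ((-1) ^ Suc k) (Suc k) h)"
    if "k < m" and e: "singular_chain k ?S e" and h: "singular_chain (Suc k) ?S h"
      and Dk: "D k = twist ((-1) ^ k) k e + chain_boundary (Suc k) h" for k e h
  proof (intro exI [of _ h] conjI h)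
    let ?s = "(-1) ^ Suc k :: int"
    have "twist ?s k (twist ((-1) ^ k) k e) = 0"
      using twist_twist [OF e, of ?s] by (simp flip: power_mult_distrib)
    then have "chain_boundary (Suc k) (D (Suc k) - twist ?s (Suc k) h) = 0"
      using chain_boundary_twist [OF h] by (simp add: chain_boundary_diff bD \<open>k < m\<close> Dk twist_add del: power_Suc)
    then show "reduced_cycle (Suc k) ?S (D (Suc k) - twist ?s (Suc k) h)"
      using chD [of "Suc k"] \<open>k < m\<close> singular_chain_twist [OF h]
      by (simp add: reduced_cycle_def singular_cycle singular_chain_diff del: power_Suc)
  qed
  \<comment> \<open>Below degree \<open>m\<close> the reduced homology of the sphere vanishes, so
    the cycle from \<open>step\<close> bounds. The \<open>h\<close> of one stage serves as the
    \<open>e\<close> of the next, starting from \<open>e = 0\<close>.\<close>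
  have comparison: "\<exists>e h. singular_chain k ?S e \<and> singular_chain (Suc k) ?S h
      \<and> D k = twist ((-1) ^ k) k e + chain_boundary (Suc k) h" if "k < m" for k
    using that
  proof (induction k)
    case 0
    then have "singular_relboundary 0 ?S {} (D 0)"
      by (intro reduced_cycle_imp_boundary D0 reduced_homology_group_nsphere(2)) simp
    then obtain h where "singular_chain (Suc 0) ?S h" "chain_boundary (Suc 0) h = D 0"
      by (auto simp: singular_boundary)
    then show ?case
      by (intro exI [of _ 0] exI [of _ h]) simp
  next
    case (Suc k)
    then obtain h where h: "singular_chain (Suc k) ?S h"
      and z: "reduced_cycle (Suc k) ?S (D (Suc k) - twist ((-1) ^ Suc k) (Suc k) h)"
      using step by (metis Suc_lessD)
    have "singular_relboundary (Suc k) ?S {} (D (Suc k) - twist ((-1) ^ Suc k) (Suc k) h)"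
      using Suc.prems by (intro reduced_cycle_imp_boundary z reduced_homology_group_nsphere(2)) simp
    then obtain h' where "singular_chain (Suc (Suc k)) ?S h'"
      "chain_boundary (Suc (Suc k)) h' = D (Suc k) - twist ((-1) ^ Suc k) (Suc k) h"
      by (auto simp: singular_boundary)
    then show ?case
      using h by (intro exI [of _ h] exI [of _ h']) (simp del: power_Suc)
  qed
  let ?s = "(-1) ^ Suc m :: int"
  \<comment> \<open>In degree \<open>m\<close> the corrected cycle need not bound, but its twist is
    even. For \<open>m = 0\<close> no correction is required, as \<open>D 0\<close> is a reduced
    cycle.\<close>
  obtain h where h: "singular_chain m ?S h" and z: "reduced_cycle m ?S (D m - twist ((-1) ^ m) m h)"
  proof (cases m)
    case 0
    then show ?thesis
      using that [of 0] D0 by simp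
  next
    case (Suc k)
    then show ?thesis
      using comparison [of k] step [of k] that by (auto simp del: power_Suc)
  qed
  have "twist ?s m (twist ((-1) ^ m) m h) = 0"
    using twist_twist [OF h, of ?s] by (simp flip: power_mult_distrib)
  then have "twist ?s m (D m) = twist ?s m (D m - twist ((-1) ^ m) m h)"
    by (simp add: twist_diff del: power_Suc)
  moreover have "even_class m (twist ?s m (D m - twist ((-1) ^ m) m h))"
    by (rule even_class_twist [OF z]) (simp add: minus_one_power_iff)
  ultimately have "even_class m (twist ?s m (D m))"
    by simp
  then have "even_class m (- twist ((-1) ^ Suc m) m (D m))"
    by (rule even_class_minus)
  moreover have "homologous_rel m ?S {} (twist ((-1) ^ Suc m) m (c m)) (- twist ((-1) ^ Suc m) m (D m))"
    \<comment> \<open>The boundary of \<open>d (Suc m)\<close> is the twist of \<open>d m\<close>,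
      which equals the twist of \<open>c m\<close> plus the twist of \<open>D m\<close>.\<close>
    unfolding homologous_rel_def singular_boundary
    using chd [of "Suc m"] bd [of m] by (intro exI [of _ "d (Suc m)"]) (simp add: D_def twist_diff del: power_Suc)
  ultimately show False
    using odd_class even_class_homologous by blast
qed

subsection \<open>The Borsuk-Ulam theorem\<close>

text \<open>Without a common zero, the vector of the \<open>h i\<close> could be normalised to unit
  length, giving an odd map from the \<open>k\<close>-sphere to the
  (\<open>k\<close>-1)-sphere.\<close>

theorem Borsuk_Ulam_nsphere:
  assumes cont: "\<And>i. i < k \<Longrightarrow> continuous_map (nsphere k) euclideanreal (h i)"
    and odd: "\<And>i x. \<lbrakk>i < k; x \<in> topspace (nsphere k)\<rbrakk> \<Longrightarrow> h i (\<lambda>j. - x j) = - h i x"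
  shows "\<exists>x \<in> topspace (nsphere k). \<forall>i<k. h i x = 0"
proof (cases k)
  case 0
  then show ?thesis
    using in_topspace_nsphere [of 0] by auto
next
  case (Suc m)
  show ?thesis
  proof (rule ccontr)
    assume "\<not> ?thesis"
    then have nz: "\<exists>i<k. h i x \<noteq> 0" if "x \<in> topspace (nsphere k)" for x
      using that by blast
    define r where "r x = sqrt (\<Sum>i<k. (h i x)\<^sup>2)" for x
    \<comment> \<open>The entries from index \<open>k\<close> on are 0, as membership in
      \<open>Euclidean_space k\<close> demands.\<close>
    define f where "f x i = (if i < k then h i x / r x else 0)" for x i
    have r: "r x > 0" if x: "x \<in> topspace (nsphere k)" for x
    proof -
      obtain i where "i < k" "h i x \<noteq> 0"
        using nz [OF x] by blast
      then have "(\<Sum>i<k. (h i x)\<^sup>2) > 0"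
        by (intro sum_pos2 [of _ i]) auto
      then show ?thesis
        by (simp add: r_def)
    qed
    have contr: "continuous_map (nsphere k) euclideanreal r"
      unfolding r_def
      by (intro continuous_map_sqrt continuous_map_sum continuous_map_real_pow cont) auto
    have "continuous_map (nsphere k) (Euclidean_space k) f"
      unfolding f_def continuous_map_componentwise_Euclidean_space
      using cont contr r by (auto intro!: continuous_map_real_divide simp: less_imp_neq [symmetric])
    moreover have "(\<Sum>i\<le>m. (f x i)\<^sup>2) = 1" if x: "x \<in> topspace (nsphere k)" for x
    proof -
      have "(\<Sum>i\<le>m. (f x i)\<^sup>2) = (\<Sum>i<k. (h i x)\<^sup>2 / (r x)\<^sup>2)"
        unfolding Suc lessThan_Suc_atMost by (intro sum.cong) (auto simp: f_def Suc power_divide)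
      also have "\<dots> = (\<Sum>i<k. (h i x)\<^sup>2) / (r x)\<^sup>2"
        by (simp add: sum_divide_distrib)
      also have "\<dots> = 1"
        using r [OF x] by (simp add: r_def sum_nonneg)
      finally show ?thesis .
    qed
    ultimately have "continuous_map (nsphere (Suc m)) (nsphere m) f"
      by (auto simp: nsphere_def [of m] continuous_map_in_subtopology Suc)
    moreover have "f (antipode x) = antipode (f x)" if "x \<in> topspace (nsphere (Suc m))" for x
    proof -
      have h: "h i (\<lambda>j. - x j) = - h i x" if "i < k" for i
        using odd [OF that] \<open>x \<in> _\<close> Suc by simp
      then have "r (\<lambda>j. - x j) = r x"
        by (simp add: r_def)
      with h show ?thesis
        by (auto simp: f_def antipode_def fun_eq_iff)
    qed
    ultimately show False
      by (rule no_odd_map_to_lower_sphere)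
  qed
qed

subsection \<open>Orthogonal vectors with equal values\<close>

lemma topspace_nsphere_inner:
  assumes "n > 0"
  shows "x \<in> topspace (nsphere (n - Suc 0)) \<longleftrightarrow> euclidean_inner n x x = 1 \<and> (\<forall>i\<ge>n. x i = 0)"
proof -
  have "{..n - Suc 0} = {..<n}"
    using assms by auto
  moreover have "(\<forall>i>n - Suc 0. x i = 0) \<longleftrightarrow> (\<forall>i\<ge>n. x i = 0)"
    using assms by (metis Suc_pred Suc_le_eq)
  ultimately show ?thesis
    by (simp add: nsphere euclidean_inner_def power2_eq_square)
qed

lemma euclidean_inner_commute: "euclidean_inner n x y = euclidean_inner n y x"
  by (simp add: euclidean_inner_def mult.commute)

lemma euclidean_inner_add_left:
  "euclidean_inner n (\<lambda>i. x i + y i) z = euclidean_inner n x z + euclidean_inner n y z"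
  by (simp add: euclidean_inner_def algebra_simps sum.distrib)

lemma euclidean_inner_scale_left: "euclidean_inner n (\<lambda>i. a * x i) z = a * euclidean_inner n x z"
  by (simp add: euclidean_inner_def algebra_simps sum_distrib_left)

lemma euclidean_inner_minus_left: "euclidean_inner n (\<lambda>i. - x i) z = - euclidean_inner n x z"
  by (simp add: euclidean_inner_def sum_negf)

lemma euclidean_inner_nonneg: "euclidean_inner n x x \<ge> 0"
  by (simp add: euclidean_inner_def sum_nonneg)

lemma continuous_map_inner:
  assumes "\<And>i. continuous_map X euclideanreal (\<lambda>x. f x i)" "\<And>i. continuous_map X euclideanreal (\<lambda>x. g x i)"
  shows "continuous_map X euclideanreal (\<lambda>x. euclidean_inner n (f x) (g x))"
  unfolding euclidean_inner_def by (intro continuous_map_sum continuous_map_real_mult assms) auto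

text \<open>Inner products with the given vectors are odd functions; padding with zero functions
  gives exactly the \<open>n - 1\<close> that Borsuk-Ulam takes.\<close>

lemma exists_unit_orthogonal:
  assumes "length us < n"
  shows "\<exists>w \<in> topspace (nsphere (n - 1)). \<forall>u \<in> set us. euclidean_inner n w u = 0"
proof -
  define h where "h i x = (if i < length us then euclidean_inner n x (us ! i) else 0)" for i x
  have "continuous_map (nsphere (n - 1)) euclideanreal (h i)" for i
    unfolding h_def by (cases "i < length us") (auto intro!: continuous_map_inner continuous_map_nsphere_projection)
  then have "\<exists>x \<in> topspace (nsphere (n - 1)). \<forall>i<n - 1. h i x = 0"
    by (rule Borsuk_Ulam_nsphere) (simp add: h_def euclidean_inner_minus_left)
  then obtain x where x: "x \<in> topspace (nsphere (n - 1))" "\<And>i. i < n - 1 \<Longrightarrow> h i x = 0"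
    by blast
  have "euclidean_inner n x (us ! i) = 0" if "i < length us" for i
    using x(2) [of i] that assms by (simp add: h_def)
  then show ?thesis
    using x(1) by (metis in_set_conv_nth)
qed

lemma orthogonal_pair_same_value:
  assumes f: "continuous_map (nsphere (n - 1)) (Euclidean_space m) f" and n: "length us + m + 1 < n"
  obtains v w where "v \<in> topspace (nsphere (n - 1))" "w \<in> topspace (nsphere (n - 1))"
    "euclidean_inner n v w = 0" "f v = f w"
    "\<forall>u \<in> set us. euclidean_inner n v u = 0 \<and> euclidean_inner n w u = 0"
proof -
  let ?S = "nsphere (n - 1)"
  let ?ip = "euclidean_inner n"
  obtain e where e: "e \<in> topspace ?S" and eu: "\<And>u. u \<in> set us \<Longrightarrow> ?ip e u = 0"
    using exists_unit_orthogonal [of us n] n by auto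
  have e1: "?ip e e = 1" and e0: "\<And>i. i \<ge> n \<Longrightarrow> e i = 0"
    using e n by (simp_all add: topspace_nsphere_inner)
  (* Projecting x away from e keeps q s x of norm at least 1, so that N is defined on the whole sphere
     without assuming that x is orthogonal to e. *)
  define q where "q s x i = e i + s * (x i - ?ip x e * e i)" for s :: real and x :: "nat \<Rightarrow> real" and i
  define N where "N s x i = q s x i / sqrt (?ip (q s x) (q s x))" for s x i
  \<comment> \<open>The displacement \<open>y\<close> from \<open>e\<close> is orthogonal to
    \<open>e\<close>, so the squared norm of \<open>q s x\<close> is 1 plus that of
    \<open>y\<close>.\<close>
  have q1: "?ip (q s x) (q s x) \<ge> 1" for s x
  proof -
    define y where "y i = s * (x i - ?ip x e * e i)" for i
    have "?ip y e = s * (\<Sum>i<n. x i * e i - ?ip x e * (e i * e i))"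
      by (simp add: y_def euclidean_inner_def sum_distrib_left algebra_simps)
    also have "\<dots> = s * (?ip x e - ?ip x e * ?ip e e)"
      by (simp add: sum_subtractf sum_distrib_left [symmetric]) (simp add: euclidean_inner_def)
    finally have "?ip y e = 0"
      by (simp add: e1)
    moreover have "q s x = (\<lambda>i. e i + y i)"
      by (simp add: q_def y_def fun_eq_iff)
    ultimately have "?ip (q s x) (q s x) = 1 + ?ip y y"
      by (simp add: euclidean_inner_add_left euclidean_inner_commute [of n _ "\<lambda>i. e i + y i"]
          e1 euclidean_inner_commute [of n e y])
    then show ?thesis
      using euclidean_inner_nonneg [of n y] by simp
  qed
  have cq: "continuous_map ?S euclideanreal (\<lambda>x. q s x i)" for s i
    unfolding q_def
    by (intro continuous_map_add continuous_map_diff continuous_map_real_mult continuous_map_inner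
        continuous_map_nsphere_projection) auto
  have cN: "continuous_map ?S ?S (N s)" for s
  proof -
    have "sqrt (?ip (q s x) (q s x)) \<noteq> 0" for x
      using q1 [of s x] by simp
    then have "continuous_map ?S euclideanreal (\<lambda>x. N s x i)" for i
      unfolding N_def by (intro continuous_map_real_divide continuous_map_sqrt continuous_map_inner cq) auto
    moreover have "N s x \<in> topspace ?S" if "x \<in> topspace ?S" for x
    proof -
      have "?ip (N s x) (N s x) = ?ip (q s x) (q s x) / (sqrt (?ip (q s x) (q s x)))\<^sup>2"
        unfolding N_def euclidean_inner_def by (simp add: sum_divide_distrib power2_eq_square)
      also have "\<dots> = 1"
        using q1 [of s x] by simp
      finally show ?thesis
        using n that e0 by (simp add: topspace_nsphere_inner) (simp add: N_def q_def)
    qed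
    ultimately show ?thesis
      unfolding nsphere continuous_map_in_subtopology continuous_map_componentwise_UNIV by auto
  qed
  define g where "g i x = f (N 1 x) i - f (N (-1) x) i" for i x
  have Nodd: "N s (\<lambda>j. - x j) = N (- s) x" for s x
  proof -
    have "q s (\<lambda>j. - x j) = q (- s) x"
      by (auto simp: q_def euclidean_inner_minus_left fun_eq_iff algebra_simps)
    then show ?thesis
      by (intro ext) (simp add: N_def)
  qed
  have "continuous_map ?S euclideanreal (\<lambda>x. f x i)" for i
    using f unfolding Euclidean_space_def continuous_map_in_subtopology continuous_map_componentwise_UNIV by simp
  then have cg: "continuous_map ?S euclideanreal (g i)" for i
    unfolding g_def using continuous_map_compose [OF cN, unfolded o_def] by (intro continuous_map_diff) auto
  define us' where "us' = e # us"
  \<comment> \<open>First come the inner products with \<open>e\<close> and \<open>us\<close>, then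
    the \<open>m\<close> components of \<open>g\<close>, then zeros. The bound \<open>n\<close>
    ensures that the first two groups fit among the indices below \<open>n - 1\<close>.\<close>
  define h where "h i x = (if i < length us' then ?ip x (us' ! i)
      else if i < length us' + m then g (i - length us') x else 0)" for i x
  have "continuous_map ?S euclideanreal (h i)" for i
    unfolding h_def
    by (cases "i < length us'"; cases "i < length us' + m")
      (auto intro!: continuous_map_inner continuous_map_nsphere_projection cg simp del: One_nat_def)
  moreover have "h i (\<lambda>j. - x j) = - h i x" for i x
    by (simp add: h_def g_def Nodd euclidean_inner_minus_left)
  ultimately have "\<exists>x \<in> topspace ?S. \<forall>i<n - 1. h i x = 0"
    by (intro Borsuk_Ulam_nsphere) auto
  then obtain x where x: "x \<in> topspace ?S" "\<And>i. i < n - 1 \<Longrightarrow> h i x = 0"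
    by blast
  have "?ip x (us' ! i) = 0" if "i < length us'" for i
    using x(2) [of i] that n by (simp add: h_def us'_def)
  then have xu: "?ip x u = 0" if "u \<in> set us'" for u
    using that by (metis in_set_conv_nth)
  have xe: "?ip x e = 0"
    using xu by (simp add: us'_def)
  have gx: "g i x = 0" if "i < m" for i
    using x(2) [of "length us' + i"] that n by (simp add: h_def us'_def)
  have x1: "?ip x x = 1"
    using x n by (simp add: topspace_nsphere_inner)
  \<comment> \<open>At the common zero, \<open>x\<close> is orthogonal to \<open>e\<close>: the
    projection changes nothing and the norm is \<open>sqrt 2\<close>.\<close>
  have Nx: "N s x = (\<lambda>i. (e i + s * x i) / sqrt 2)" if "s\<^sup>2 = 1" for s
  proof -
    have "q s x = (\<lambda>i. e i + s * x i)"
      by (rule ext) (simp add: q_def xe)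
    moreover have "?ip (\<lambda>i. e i + s * x i) (\<lambda>i. e i + s * x i) = 2"
      using that
      by (simp add: euclidean_inner_add_left euclidean_inner_scale_left euclidean_inner_commute [of n _ "\<lambda>i. e i + s * x i"]
          e1 x1 xe euclidean_inner_commute [of n e x] power2_eq_square)
    ultimately show ?thesis
      by (intro ext) (simp add: N_def)
  qed
  have N_inner: "?ip (N s x) z = (?ip e z + s * ?ip x z) / sqrt 2" if "s\<^sup>2 = 1" for s z
    unfolding Nx [OF that] euclidean_inner_def
    by (simp add: sum_divide_distrib sum.distrib sum_distrib_left algebra_simps add_divide_distrib)
  have fN: "f (N s x) \<in> topspace (Euclidean_space m)" and NS: "N s x \<in> topspace ?S" for s
    using x(1) continuous_map_funspace [OF f] continuous_map_funspace [OF cN] by blast+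
  show thesis
  proof (rule that [of "N 1 x" "N (-1) x"])
    show "f (N 1 x) = f (N (-1) x)"
    proof
      fix i
      \<comment> \<open>Below \<open>m\<close> this is the vanishing of \<open>g\<close>; from
        \<open>m\<close> on both sides are 0 in \<open>Euclidean_space m\<close>.\<close>
      show "f (N 1 x) i = f (N (-1) x) i"
        using gx [of i] fN [of 1] fN [of "-1"]
        by (cases "i < m") (auto simp: g_def topspace_Euclidean_space)
    qed
    have "?ip e (N (-1) x) = 1 / sqrt 2" "?ip x (N (-1) x) = - 1 / sqrt 2"
      using N_inner [of "-1" e] N_inner [of "-1" x]
      by (simp_all add: euclidean_inner_commute [of n _ "N (-1) x"] xe e1 x1 euclidean_inner_commute [of n e x])
    then show "?ip (N 1 x) (N (-1) x) = 0"
      using N_inner [of 1 "N (-1) x"] by simp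
  qed (use NS N_inner xu eu in \<open>auto simp: us'_def\<close>)
qed

text \<open>By symmetry of the inner product, pairs of positions i < j suffice; on explicit lists
  \<open>sorted_wrt\<close> unfolds by simplification.\<close>

lemma mutually_orthogonal_iff_sorted:
  "mutually_orthogonal n vs \<longleftrightarrow> sorted_wrt (\<lambda>v w. euclidean_inner n v w = 0) vs"
proof
  assume "mutually_orthogonal n vs"
  then show "sorted_wrt (\<lambda>v w. euclidean_inner n v w = 0) vs"
    by (auto simp: mutually_orthogonal_def sorted_wrt_iff_nth_less)
next
  assume s: "sorted_wrt (\<lambda>v w. euclidean_inner n v w = 0) vs"
  show "mutually_orthogonal n vs"
    unfolding mutually_orthogonal_def
  proof (intro allI impI)
    fix i j
    assume "i < length vs" "j < length vs" "i \<noteq> j"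
    then show "euclidean_inner n (vs ! i) (vs ! j) = 0"
      using s euclidean_inner_commute [of n "vs ! i"] unfolding sorted_wrt_iff_nth_less
      by (metis linorder_neqE_nat)
  qed
qed

theorem theoremD:
  shows "(\<forall>n\<ge>2. \<forall>f. continuous_map (nsphere (n - 1)) (Euclidean_space (n - 2)) f \<longrightarrow>
            (\<exists>v1 v2. {v1, v2} \<subseteq> topspace (nsphere (n - 1)) \<and>
               mutually_orthogonal n [v1, v2] \<and> f v1 = f v2))
       \<and> (\<forall>n\<ge>4. \<forall>f. continuous_map (nsphere (n - 1)) (Euclidean_space (n div 2 - 2)) f \<longrightarrow>
            (\<exists>v1 v2 v3 v4. {v1, v2, v3, v4} \<subseteq> topspace (nsphere (n - 1)) \<and>
               mutually_orthogonal n [v1, v2, v3, v4] \<and> f v1 = f v2 \<and> f v3 = f v4))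
       \<and> (\<forall>n\<ge>6. \<forall>f. continuous_map (nsphere (n - 1)) (Euclidean_space ((n - r_offset n - 1) div 3)) f \<longrightarrow>
            (\<exists>v1 v2 v3 v4 v5 v6. {v1, v2, v3, v4, v5, v6} \<subseteq> topspace (nsphere (n - 1)) \<and>
               mutually_orthogonal n [v1, v2, v3, v4, v5, v6] \<and>
               f v1 = f v2 \<and> f v3 = f v4 \<and> f v5 = f v6))"
proof (intro conjI allI impI)
  fix n :: nat and f
  assume "n \<ge> 2" and f: "continuous_map (nsphere (n - 1)) (Euclidean_space (n - 2)) f"
  then have "length [] + (n - 2) + 1 < n"
    by simp
  from orthogonal_pair_same_value [OF f this] obtain v1 v2
    where "v1 \<in> topspace (nsphere (n - 1))" "v2 \<in> topspace (nsphere (n - 1))"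
      "euclidean_inner n v1 v2 = 0" "f v1 = f v2"
    by metis
  then have "{v1, v2} \<subseteq> topspace (nsphere (n - 1)) \<and> mutually_orthogonal n [v1, v2] \<and> f v1 = f v2"
    unfolding mutually_orthogonal_iff_sorted by simp
  then show "\<exists>v1 v2. {v1, v2} \<subseteq> topspace (nsphere (n - 1)) \<and> mutually_orthogonal n [v1, v2] \<and> f v1 = f v2"
    by blast
next
  fix n :: nat and f
  let ?m = "n div 2 - 2"
  assume n: "n \<ge> 4" and f: "continuous_map (nsphere (n - 1)) (Euclidean_space ?m) f"
  obtain v1 v2 where v12: "v1 \<in> topspace (nsphere (n - 1))" "v2 \<in> topspace (nsphere (n - 1))"
      "euclidean_inner n v1 v2 = 0" "f v1 = f v2"
  proof (rule orthogonal_pair_same_value [OF f])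
    show "length [] + ?m + 1 < n"
      using n by simp
  qed
  obtain v3 v4 where v34: "v3 \<in> topspace (nsphere (n - 1))" "v4 \<in> topspace (nsphere (n - 1))"
      "euclidean_inner n v3 v4 = 0" "f v3 = f v4"
      "\<forall>u \<in> set [v1, v2]. euclidean_inner n v3 u = 0 \<and> euclidean_inner n v4 u = 0"
  proof (rule orthogonal_pair_same_value [OF f])
    show "length [v1, v2] + ?m + 1 < n"
      using n by simp
  qed
  \<comment> \<open>The later pair is listed first, matching the argument order in which its
    orthogonality to the earlier pair was obtained.\<close>
  have "mutually_orthogonal n [v3, v4, v1, v2]"
    unfolding mutually_orthogonal_iff_sorted using v12 v34 by simp
  with v12 v34 have "{v3, v4, v1, v2} \<subseteq> topspace (nsphere (n - 1)) \<and>
      mutually_orthogonal n [v3, v4, v1, v2] \<and> f v3 = f v4 \<and> f v1 = f v2"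
    by simp
  then show "\<exists>v1 v2 v3 v4. {v1, v2, v3, v4} \<subseteq> topspace (nsphere (n - 1)) \<and>
      mutually_orthogonal n [v1, v2, v3, v4] \<and> f v1 = f v2 \<and> f v3 = f v4"
    by blast
next
  fix n :: nat and f
  let ?m = "(n - r_offset n - 1) div 3"
  assume n: "n \<ge> 6" and f: "continuous_map (nsphere (n - 1)) (Euclidean_space ?m) f"
  \<comment> \<open>The third pair has to avoid four vectors, which requires
    \<open>4 + ?m + 1 < n\<close>.\<close>
  have m: "?m + 5 < n"
  proof (cases "n = 6")
    case True
    then show ?thesis
      by (simp add: r_offset_def)
  next
    case False
    have "r_offset n \<ge> 3"
      by (simp add: r_offset_def)
    then have "?m \<le> (n - 4) div 3"
      by (intro div_le_mono) simp
    then show ?thesis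
      using n False by linarith
  qed
  obtain v1 v2 where v12: "v1 \<in> topspace (nsphere (n - 1))" "v2 \<in> topspace (nsphere (n - 1))"
      "euclidean_inner n v1 v2 = 0" "f v1 = f v2"
  proof (rule orthogonal_pair_same_value [OF f])
    show "length [] + ?m + 1 < n"
      using m by simp
  qed
  obtain v3 v4 where v34: "v3 \<in> topspace (nsphere (n - 1))" "v4 \<in> topspace (nsphere (n - 1))"
      "euclidean_inner n v3 v4 = 0" "f v3 = f v4"
      "\<forall>u \<in> set [v1, v2]. euclidean_inner n v3 u = 0 \<and> euclidean_inner n v4 u = 0"
  proof (rule orthogonal_pair_same_value [OF f])
    show "length [v1, v2] + ?m + 1 < n"
      using m by simp
  qed
  obtain v5 v6 where v56: "v5 \<in> topspace (nsphere (n - 1))" "v6 \<in> topspace (nsphere (n - 1))"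
      "euclidean_inner n v5 v6 = 0" "f v5 = f v6"
      "\<forall>u \<in> set [v1, v2, v3, v4]. euclidean_inner n v5 u = 0 \<and> euclidean_inner n v6 u = 0"
  proof (rule orthogonal_pair_same_value [OF f])
    show "length [v1, v2, v3, v4] + ?m + 1 < n"
      using m by simp
  qed
  have "mutually_orthogonal n [v5, v6, v3, v4, v1, v2]"
    unfolding mutually_orthogonal_iff_sorted using v12 v34 v56 by simp
  with v12 v34 v56 have "{v5, v6, v3, v4, v1, v2} \<subseteq> topspace (nsphere (n - 1)) \<and>
      mutually_orthogonal n [v5, v6, v3, v4, v1, v2] \<and> f v5 = f v6 \<and> f v3 = f v4 \<and> f v1 = f v2"
    by simp
  then show "\<exists>v1 v2 v3 v4 v5 v6. {v1, v2, v3, v4, v5, v6} \<subseteq> topspace (nsphere (n - 1)) \<and>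
      mutually_orthogonal n [v1, v2, v3, v4, v5, v6] \<and> f v1 = f v2 \<and> f v3 = f v4 \<and> f v5 = f v6"
    by blast
qed

end
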